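(* Let $q$ be a prime power and $n\ge 1$. For $f\in\mathrm{Per}(\mathbb{F}_q^n)$ and $0\le k\le n$, let $k\text{-affinity}(f)$ be the number of $k$-flats $X$ of $\mathbb{F}_q^n$ such that $f(X)$ is also a $k$-flat. Then: (i) If $q=2$ and $n\ge 3$ is odd, there exists $f\in\mathrm{Per}(\mathbb{F}_2^n)$ with $2\text{-affinity}(f)=0$. (ii) If $q=2$ and $n\ge 4$, there exists $f\in\mathrm{Per}(\mathbb{F}_2^n)$ with $k\text{-affinity}(f)=0$ for all $3\le k\le n-1$. (iii) If $q\ge 4$ and $n\ge 2$, there exists $f\in\mathrm{Per}(\mathbb{F}_q^n)$ with $k\text{-affinity}(f)=0$ for all $1\le k\le n-1$. (iv) If $q=3$ and $n\ge 3$, there exists $f\in\mathrm{Per}(\mathbb{F}_3^n)$ with $k\text{-affinity}(f)=0$ for all $2\le k\le n-1$. (v) If $q=3$ and $n\ge 2$, there exists $f\in\mathrm{Per}(\mathbb{F}_3^n)$ with $1\text{-affinity}(f)=0$.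
   Context: $\mathbb{F}_q$ is the finite field with $q$ elements, $\mathbb{F}_q^n$ the $n$-dimensional vector space over it, and $\mathrm{Per}(\mathbb{F}_q^n)$ the group of all permutations (bijections) of $\mathbb{F}_q^n$. A $k$-flat of $\mathbb{F}_q^n$ is a coset $U+x$ of a $k$-dimensional linear subspace $U$. *)

theory Defs
  imports "HOL-Analysis.Cartesian_Space"
begin

definition is_flat :: "nat \<Rightarrow> ('a::field ^ 'n) set \<Rightarrow> bool" where
  "is_flat k X \<longleftrightarrow>
     (\<exists>U x. vec.subspace U \<and> vec.dim U = k \<and> X = (\<lambda>u. u + x) ` U)"

text \<open>Over a finite field the set below is finite, so \<open>card\<close> is a genuine count.\<close>

definition affinity :: "nat \<Rightarrow> ('a::{field,finite} ^ 'n \<Rightarrow> 'a ^ 'n) \<Rightarrow> nat" where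
  "affinity k f = card {X. is_flat k X \<and> is_flat k (f ` X)}"

end

theory Submission
  imports Defs "HOL-Combinatorics.Permutations" "HOL-Algebra.Algebraic_Closure_Type"
    "HOL-Number_Theory.Residues"
begin

text \<open>
  Parts (ii)--(iv) are a union bound over a random permutation. Put \<open>N = q^n\<close>, \<open>Q = q^k\<close> and
  \<open>r i = (N - i) / (Q - i)\<close>, which is at least 2 and increases with \<open>i\<close>. The number of
  \<open>k\<close>-flats is \<open>r 0 * r 1 * r q * ... * r (q^(k-1))\<close>, while \<open>N choose Q\<close> is the product of all
  \<open>r i\<close> with \<open>i < Q\<close>. In \<open>(number of k-flats)^2 / (N choose Q)\<close>, the expected number of
  \<open>k\<close>-flats mapped to \<open>k\<close>-flats, one copy of the flat count cancels. The other is outweighed by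
  the last \<open>k\<close> factors of the denominator, with a factor 2 to spare since \<open>r (Q - 1)\<close> is so
  large, and by one further factor against \<open>r 0\<close>. What remains of the denominator is at least
  \<open>2^(q^k - 2 * k - 1)\<close>, and the expectations have sum less than 1 as soon as the smallest
  dimension \<open>k\<close> satisfies \<open>2 * k + 2 \<le> q^k\<close>.

  For (i) and (v), identify \<open>F_q^n\<close> with the subfield \<open>{x. x^(q^n) = x}\<close> of the algebraic
  closure. A flat with more than two points has sum 0. In (i) take \<open>x^3\<close>, a bijection since 3
  does not divide \<open>2^n - 1\<close>, which maps no 4-set with sum 0 to another. In (v), inversion
  destroys all zero-sum triples except those through 0; these are repaired by cyclically permuting
  the values at 0, 1 and \<open>b\<close>, where \<open>1 - b\<close> is a nonsquare other than \<open>-1\<close>.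
\<close>

section \<open>Flats over a finite field\<close>

lemma two_le_CARD: "2 \<le> CARD('a::{zero_neq_one,finite})"
  using card_mono[of "UNIV :: 'a set" "{0, 1}"] by simp

lemma of_nat_CARD_eq_0: "of_nat CARD('a::{ring_1,finite}) = (0 :: 'a)"
  by (simp add: of_nat_eq_0_iff_char_dvd CHAR_dvd_CARD)

lemma sum_UNIV_field_eq_0:
  assumes "2 < CARD('a::{field,finite})"
  shows "(\<Sum>a\<in>UNIV. a) = (0 :: 'a)"
proof -
  have "\<not> UNIV \<subseteq> {0, 1 :: 'a}"
    using assms card_mono[of "{0, 1}" "UNIV :: 'a set"] by auto
  then obtain c :: 'a where c: "c \<noteq> 0" "c \<noteq> 1" by blast
  have "(\<Sum>a\<in>UNIV. a) = (\<Sum>a\<in>UNIV. c * a)"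
    by (rule sum.reindex_bij_witness[of _ "\<lambda>a. c * a" "\<lambda>a. a / c"]) (use c in auto)
  then have "(1 - c) * (\<Sum>a\<in>UNIV. a) = 0"
    by (simp add: left_diff_distrib flip: sum_distrib_left)
  with c show ?thesis by simp
qed

lemma sum_PiE_coordinate_eq_0:
  assumes "finite B" "v \<in> B" and large: "2 < CARD('a::{field,finite}) ^ card B"
  shows "(\<Sum>c\<in>B \<rightarrow>\<^sub>E UNIV. c v) = (0 :: 'a)"
proof -
  let ?f = "\<lambda>w (a::'a). if w = v then a else 1"
  have "(\<Sum>c\<in>B \<rightarrow>\<^sub>E UNIV. c v) = (\<Sum>c\<in>B \<rightarrow>\<^sub>E UNIV. \<Prod>w\<in>B. ?f w (c w))"
    using assms(1,2) by (simp add: prod.delta)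
  also have "\<dots> = (\<Prod>w\<in>B. \<Sum>a\<in>UNIV. ?f w a)"
    using assms(1) by (simp add: prod_sum_PiE)
  also have "\<dots> = (\<Sum>a\<in>UNIV. a) * (\<Prod>w\<in>B - {v}. of_nat CARD('a))"
    using assms(1,2) by (simp add: prod.remove)
  also have "\<dots> = 0"
  proof (cases "B = {v}")
    case True
    then show ?thesis
      using sum_UNIV_field_eq_0[where 'a = 'a] large by simp
  next
    case False
    then have "B - {v} \<noteq> {}"
      using assms(2) by blast
    then show ?thesis
      using assms(1) by (simp add: of_nat_CARD_eq_0 card_gt_0_iff)
  qed
  finally show ?thesis .
qed

context vector_space
begin

lemma bij_betw_PiE_span:
  assumes B: "finite B" "independent B"
  shows "bij_betw (\<lambda>c. \<Sum>v\<in>B. scale (c v) v) (B \<rightarrow>\<^sub>E UNIV) (span B)"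
proof (intro bij_betw_imageI inj_onI)
  fix c d assume cd: "c \<in> B \<rightarrow>\<^sub>E UNIV" "d \<in> B \<rightarrow>\<^sub>E UNIV"
    and eq: "(\<Sum>v\<in>B. scale (c v) v) = (\<Sum>v\<in>B. scale (d v) v)"
  have "(\<Sum>v\<in>B. scale (c v - d v) v) = 0"
    using eq by (simp add: scale_left_diff_distrib sum_subtractf)
  then have "c v = d v" if "v \<in> B" for v
    using independentD[OF B(2,1) order_refl, of "\<lambda>v. c v - d v"] that by simp
  then show "c = d"
    using cd by (auto intro: PiE_ext)
next
  have "(\<Sum>v\<in>B. scale (c v) v) = (\<Sum>v\<in>B. scale (restrict c B v) v)" for c
    by (intro sum.cong) auto
  then show "(\<lambda>c. \<Sum>v\<in>B. scale (c v) v) ` (B \<rightarrow>\<^sub>E UNIV) = span B"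
    unfolding span_finite[OF B(1)] by (fastforce simp: image_iff)
qed

lemma card_span_independent:
  assumes "finite B" "independent B"
  shows "card (span B) = CARD('a) ^ card B"
  using bij_betw_same_card[OF bij_betw_PiE_span[OF assms]] assms(1)
  by (simp add: card_PiE)

lemma card_subspace:
  assumes "finite U" "subspace U"
  shows "card U = CARD('a) ^ dim U"
proof -
  obtain B where B: "B \<subseteq> U" "independent B" "U \<subseteq> span B" "card B = dim U"
    by (rule basis_exists)
  then have "span B = U"
    using assms(2) by (simp add: span_minimal subset_antisym)
  then show ?thesis
    using card_span_independent[of B] B assms(1) finite_subset by auto
qed

end

lemma sum_subspace_eq_0:
  fixes U :: "('a::{field,finite} ^ 'n) set"
  assumes U: "vec.subspace U" and large: "2 < CARD('a) ^ vec.dim U"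
  shows "\<Sum>U = 0"
proof -
  obtain B where B: "B \<subseteq> U" "vec.independent B" "U \<subseteq> vec.span B" "card B = vec.dim U"
    by (rule vec.basis_exists)
  have "\<Sum>U = \<Sum>(vec.span B)"
    using B U by (metis vec.span_minimal subset_antisym)
  also have "\<dots> = (\<Sum>c\<in>B \<rightarrow>\<^sub>E UNIV. \<Sum>v\<in>B. c v *s v)"
    using sum.reindex_bij_betw[OF vec.bij_betw_PiE_span[OF _ B(2)], of "\<lambda>x. x"] by simp
  also have "\<dots> = (\<Sum>v\<in>B. (\<Sum>c\<in>B \<rightarrow>\<^sub>E UNIV. c v) *s v)"
    by (subst sum.swap) (simp add: vec.scale_sum_left)
  also have "\<dots> = 0"
    using sum_PiE_coordinate_eq_0[where 'a = 'a, of B] large B(4) by (intro sum.neutral) simp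
  finally show ?thesis .
qed

lemma card_flat:
  fixes Z :: "('a::{field,finite} ^ 'n) set"
  assumes "is_flat k Z"
  shows "card Z = CARD('a) ^ k"
  using assms unfolding is_flat_def
  by (auto simp: card_image vec.card_subspace)

lemma sum_flat_eq_0:
  fixes Z :: "('a::{field,finite} ^ 'n) set"
  assumes Z: "is_flat k Z" and large: "2 < CARD('a) ^ k"
  shows "\<Sum>Z = 0"
proof -
  obtain U x where U: "vec.subspace U" "vec.dim U = k" "Z = (\<lambda>u. u + x) ` U"
    using Z by (auto simp: is_flat_def)
  have "k \<noteq> 0"
    using large by (intro notI) simp
  then have "of_nat (card U) = (0 :: 'a)"
    using vec.card_subspace[OF _ U(1)] U(2) by (simp add: of_nat_CARD_eq_0)
  then have "(\<Sum>u\<in>U. x) = 0"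
    by (simp add: vec_eq_iff of_nat_index)
  moreover have "\<Sum>U = 0"
    using U large by (intro sum_subspace_eq_0) auto
  ultimately show ?thesis
    using U(3) by (simp add: sum.reindex sum.distrib)
qed

lemma affinity_eq_0_iff:
  "affinity k f = 0 \<longleftrightarrow> (\<forall>Z. is_flat k Z \<longrightarrow> \<not> is_flat k (f ` Z))"
  by (auto simp: affinity_def)

definition independent_lists :: "('a::field ^ 'n) set \<Rightarrow> nat \<Rightarrow> ('a ^ 'n) list set" where
  "independent_lists U k =
     {xs. set xs \<subseteq> U \<and> length xs = k \<and> distinct xs \<and> vec.independent (set xs)}"

lemma finite_independent_lists [simp]:
  "finite (independent_lists (U :: ('a::{field,finite} ^ 'n) set) k)"
  by (rule finite_subset[OF _ finite_lists_length_eq[of U k]])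
     (auto simp: independent_lists_def)

lemma card_independent_lists:
  fixes U :: "('a::{field,finite} ^ 'n) set"
  assumes U: "vec.subspace U"
  shows "card (independent_lists U k) = (\<Prod>i<k. CARD('a) ^ vec.dim U - CARD('a) ^ i)"
proof (induction k)
  case 0
  have "independent_lists U 0 = {[]}"
    by (auto simp: independent_lists_def vec.independent_empty)
  then show ?case by simp
next
  case (Suc k)
  let ?cons = "\<lambda>(xs, x). x # xs"
  let ?S = "SIGMA xs : independent_lists U k. U - vec.span (set xs)"
  have eq: "independent_lists U (Suc k) = ?cons ` ?S"
  proof (intro Set.set_eqI iffI)
    fix ys assume "ys \<in> independent_lists U (Suc k)"
    then obtain x xs where "ys = x # xs" "(xs, x) \<in> ?S"
      by (cases ys) (auto simp: independent_lists_def vec.independent_insert)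
    then show "ys \<in> ?cons ` ?S" by force
  next
    fix ys assume "ys \<in> ?cons ` ?S"
    then show "ys \<in> independent_lists U (Suc k)"
      by (auto simp: independent_lists_def vec.span_base dest: vec.independent_insertI)
  qed
  have "card (U - vec.span (set xs)) = CARD('a) ^ vec.dim U - CARD('a) ^ k"
    if "xs \<in> independent_lists U k" for xs
  proof -
    have xs: "set xs \<subseteq> U" "vec.independent (set xs)" "card (set xs) = k"
      using that by (auto simp: independent_lists_def distinct_card)
    moreover have "vec.span (set xs) \<subseteq> U"
      using xs U by (simp add: vec.span_minimal)
    ultimately show ?thesis
      using vec.card_span_independent[of "set xs"] vec.card_subspace[OF _ U]
      by (simp add: card_Diff_subset)
  qed
  then have "card ?S = card (independent_lists U k) * (CARD('a) ^ vec.dim U - CARD('a) ^ k)"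
    by (simp add: card_SigmaI)
  moreover have "inj_on ?cons ?S"
    by (auto simp: inj_on_def)
  ultimately show ?case
    by (simp add: eq card_image Suc.IH)
qed

definition affine_frames :: "nat \<Rightarrow> ('a::field ^ 'n) set \<Rightarrow> (('a ^ 'n) \<times> ('a ^ 'n) list) set" where
  "affine_frames k Z =
     {(x, xs). xs \<in> independent_lists UNIV k \<and> (\<lambda>u. u + x) ` vec.span (set xs) = Z}"

lemma translate_subspace_by_member:
  assumes U: "vec.subspace U" and y: "y \<in> (\<lambda>u. u + x) ` U"
  shows "(\<lambda>u. u + y) ` U = (\<lambda>u. u + x) ` U"
proof -
  obtain w where w: "w \<in> U" "y = w + x"
    using y by auto
  have "(\<lambda>u. u + w) ` U = U"
  proof (intro equalityI image_subsetI subsetI)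
    fix u assume u: "u \<in> U"
    show "u + w \<in> U"
      using U u w(1) by (rule vec.subspace_add)
    show "u \<in> (\<lambda>u. u + w) ` U"
      using vec.subspace_diff[OF U u w(1)] by (rule rev_image_eqI) simp
  qed
  then have "(\<lambda>u. u + x) ` (\<lambda>u. u + w) ` U = (\<lambda>u. u + x) ` U"
    by simp
  then show ?thesis
    by (simp add: image_image w(2) add.assoc)
qed

lemma translate_subspace_eq_iff:
  assumes U: "vec.subspace U" and V: "vec.subspace V"
  shows "(\<lambda>v. v + y) ` V = (\<lambda>u. u + x) ` U \<longleftrightarrow> V = U \<and> y \<in> (\<lambda>u. u + x) ` U"
proof
  assume eq: "(\<lambda>v. v + y) ` V = (\<lambda>u. u + x) ` U"
  have "0 + y \<in> (\<lambda>v. v + y) ` V"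
    using vec.subspace_0[OF V] by (rule imageI)
  then have y: "y \<in> (\<lambda>u. u + x) ` U"
    by (simp add: eq)
  then have "(\<lambda>v. v + y) ` V = (\<lambda>v. v + y) ` U"
    by (simp add: eq translate_subspace_by_member[OF U])
  then have "V = U"
    by (simp add: inj_image_eq_iff)
  with y show "V = U \<and> y \<in> (\<lambda>u. u + x) ` U" by simp
qed (simp add: translate_subspace_by_member[OF U])

lemma affine_frames_translate_subspace:
  fixes U :: "('a::{field,finite} ^ 'n) set"
  assumes U: "vec.subspace U" "vec.dim U = k"
  shows "affine_frames k ((\<lambda>u. u + x) ` U) = (\<lambda>u. u + x) ` U \<times> independent_lists U k"
proof -
  have span: "vec.span (set xs) = U \<longleftrightarrow> set xs \<subseteq> U"
    if "xs \<in> independent_lists UNIV k" for xs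
  proof
    assume xs: "set xs \<subseteq> U"
    have "vec.dim U \<le> card (set xs)"
      using that U(2) by (simp add: independent_lists_def distinct_card)
    then have "U \<subseteq> vec.span (set xs)"
      using vec.card_ge_dim_independent[OF xs] that by (simp add: independent_lists_def)
    then show "vec.span (set xs) = U"
      using vec.span_minimal[OF xs U(1)] by simp
  qed (use vec.span_superset in blast)
  have "(y, xs) \<in> affine_frames k ((\<lambda>u. u + x) ` U) \<longleftrightarrow>
      y \<in> (\<lambda>u. u + x) ` U \<and> xs \<in> independent_lists U k" for y xs
  proof -
    have "(y, xs) \<in> affine_frames k ((\<lambda>u. u + x) ` U) \<longleftrightarrow>
        xs \<in> independent_lists UNIV k \<and> set xs \<subseteq> U \<and> y \<in> (\<lambda>u. u + x) ` U"
      unfolding affine_frames_def mem_Collect_eq case_prod_conv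
        translate_subspace_eq_iff[OF U(1) vec.subspace_span]
      using span by blast
    then show ?thesis
      by (simp only: independent_lists_def mem_Collect_eq) blast
  qed
  then show ?thesis by (intro Set.set_eqI) (simp only: split_paired_all mem_Sigma_iff)
qed

lemma card_flats:
  "card {Z :: ('a::{field,finite} ^ 'n) set. is_flat k Z} *
      (CARD('a) ^ k * (\<Prod>i<k. CARD('a) ^ k - CARD('a) ^ i)) =
    CARD('a) ^ CARD('n) * (\<Prod>i<k. CARD('a) ^ CARD('n) - CARD('a) ^ i)"
proof -
  let ?F = "{Z :: ('a ^ 'n) set. is_flat k Z}"
  let ?L = "independent_lists (UNIV :: ('a ^ 'n) set) k"
  have card_frames: "card (affine_frames k Z) = CARD('a) ^ k * (\<Prod>i<k. CARD('a) ^ k - CARD('a) ^ i)"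
    if Z: "Z \<in> ?F" for Z
  proof -
    obtain U x where U: "vec.subspace U" "vec.dim U = k" "Z = (\<lambda>u. u + x) ` U"
      using Z by (auto simp: is_flat_def)
    then have "card (affine_frames k Z) = card Z * card (independent_lists U k)"
      by (simp add: affine_frames_translate_subspace card_cartesian_product)
    with U show ?thesis
      using card_flat[of k Z] Z by (simp add: card_independent_lists)
  qed
  have "is_flat k ((\<lambda>u. u + x) ` vec.span (set xs))" if "xs \<in> ?L" for x xs
  proof -
    have "vec.dim (vec.span (set xs)) = k"
      using that vec.dim_span_eq_card_independent[of "set xs"]
      by (simp add: independent_lists_def distinct_card)
    then show ?thesis
      unfolding is_flat_def using vec.subspace_span by blast
  qed
  then have frames: "(\<Union>Z\<in>?F. affine_frames k Z) = UNIV \<times> ?L"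
    by (auto simp: affine_frames_def)
  have "card ?F * (CARD('a) ^ k * (\<Prod>i<k. CARD('a) ^ k - CARD('a) ^ i))
      = (\<Sum>Z\<in>?F. card (affine_frames k Z))"
    by (simp add: card_frames)
  also have "\<dots> = card (\<Union>Z\<in>?F. affine_frames k Z)"
  proof (rule card_UN_disjoint[symmetric])
    show "\<forall>Z\<in>?F. finite (affine_frames k Z)"
      using frames by (metis UN_upper finite_subset finite_SigmaI finite finite_independent_lists)
  qed (auto simp: affine_frames_def)
  also have "\<dots> = CARD('a) ^ CARD('n) * (\<Prod>i<k. CARD('a) ^ CARD('n) - CARD('a) ^ i)"
    using card_independent_lists[OF vec.subspace_UNIV, where 'a = 'a and 'n = 'n, of k]
    by (simp add: frames card_cartesian_product card_cart_basis)
  finally show ?thesis .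
qed

section \<open>A union bound for random permutations\<close>

lemma exists_permutes_image_eq:
  assumes S: "finite S" and sub: "A \<subseteq> S" "B \<subseteq> S" and card: "card A = card B"
  obtains p where "p permutes S" "p ` A = B"
proof -
  have fin: "finite A" "finite B"
    using sub S by (auto intro: finite_subset)
  obtain f where f: "bij_betw f A B"
    using finite_same_card_bij[OF fin card] ..
  have "card (S - A) = card (S - B)"
    using fin sub card by (simp add: card_Diff_subset)
  then obtain g where g: "bij_betw g (S - A) (S - B)"
    using finite_same_card_bij[of "S - A" "S - B"] S by auto
  define p where "p x = (if x \<in> A then f x else if x \<in> S then g x else x)" for x
  have p: "bij_betw p A B"
    using f by (subst bij_betw_cong[of A p f]) (auto simp: p_def)
  have "bij_betw p (S - A) (S - B)"
    using g by (subst bij_betw_cong[of "S - A" p g]) (auto simp: p_def)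
  with p have "bij_betw p (A \<union> (S - A)) (B \<union> (S - B))"
    by (rule bij_betw_combine) blast
  then have "bij_betw p S S"
    using sub by (simp add: Un_absorb1)
  then have "p permutes S"
    using sub by (intro bij_imp_permutes) (auto simp: p_def)
  moreover have "p ` A = B"
    using p by (simp add: bij_betw_def)
  ultimately show ?thesis by (rule that)
qed

lemma card_permutes_image_le:
  assumes S: "finite S" and YZ: "Y \<subseteq> S" "Z \<subseteq> S" "card Y = card Z"
  shows "card {f. f permutes S \<and> f ` A = Y} \<le> card {f. f permutes S \<and> f ` A = Z}"
    (is "card (?P Y) \<le> card (?P Z)")
proof -
  obtain p where p: "p permutes S" "p ` Y = Z"
    using exists_permutes_image_eq[OF S YZ] .
  have "inj_on ((\<circ>) p) (?P Y)"
    by (rule inj_on_subset[OF fun.inj_map[OF permutes_inj[OF p(1)]] subset_UNIV])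
  moreover have "(\<circ>) p ` ?P Y \<subseteq> ?P Z"
  proof (rule image_subsetI)
    fix f assume f: "f \<in> ?P Y"
    then have "(p \<circ> f) ` A = Z"
      using p(2) unfolding image_comp[symmetric] by simp
    with f show "p \<circ> f \<in> ?P Z"
      using permutes_compose[OF _ p(1)] by simp
  qed
  moreover have "finite (?P Z)"
    using finite_permutations[OF S] by (rule rev_finite_subset) blast
  ultimately show ?thesis
    by (rule card_inj_on_le)
qed

lemma card_permutes_image_eq:
  assumes S: "finite S" and sub: "A \<subseteq> S" "B \<subseteq> S" and card: "card A = card B"
  shows "card {f. f permutes S \<and> f ` A = B} * (card S choose card A) = fact (card S)"
proof -
  let ?P = "\<lambda>Y. {f. f permutes S \<and> f ` A = Y}"
  let ?M = "{Y. Y \<subseteq> S \<and> card Y = card A}"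
  have P: "card (?P Y) = card (?P B)" if "Y \<in> ?M" for Y
    using that sub(2) card by (intro antisym card_permutes_image_le[OF S]) auto
  have fin: "finite (?P Y)" for Y
    using finite_permutations[OF S] by (rule rev_finite_subset) blast
  have M: "finite ?M"
    using S by simp
  have "fact (card S) = card {f. f permutes S}"
    using S by (simp add: card_permutations)
  also have "{f. f permutes S} = (\<Union>Y\<in>?M. ?P Y)"
  proof -
    have "f ` A \<in> ?M" if "f permutes S" for f
      using image_mono[OF sub(1), of f] permutes_image[OF that]
        card_image[OF permutes_inj_on[OF that], of A] by simp
    then show ?thesis by blast
  qed
  also have "card \<dots> = (\<Sum>Y\<in>?M. card (?P Y))"
    using M fin by (intro card_UN_disjoint) auto
  also have "\<dots> = card (?P B) * card ?M"
    by (simp add: P)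
  also have "card ?M = card S choose card A"
    using S by (rule n_subsets)
  finally show ?thesis by simp
qed

lemma exists_permutes_image_neq:
  assumes S: "finite S" and I: "finite I"
    and sub: "\<And>i. i \<in> I \<Longrightarrow> A i \<subseteq> S" "\<And>i. i \<in> I \<Longrightarrow> B i \<subseteq> S"
    and card: "\<And>i. i \<in> I \<Longrightarrow> card (A i) = card (B i)"
    and less: "(\<Sum>i\<in>I. 1 / real (card S choose card (A i))) < 1"
  shows "\<exists>f. f permutes S \<and> (\<forall>i\<in>I. f ` A i \<noteq> B i)"
proof (rule ccontr)
  let ?P = "\<lambda>i. {f. f permutes S \<and> f ` A i = B i}"
  assume "\<not> ?thesis"
  then have "{f. f permutes S} \<subseteq> (\<Union>i\<in>I. ?P i)"
    by auto
  then have "card {f. f permutes S} \<le> card (\<Union>i\<in>I. ?P i)"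
    using S I by (intro card_mono) (auto simp: finite_permutations)
  also have "\<dots> \<le> (\<Sum>i\<in>I. card (?P i))"
    by (rule card_UN_le[OF I])
  finally have "real (card {f. f permutes S}) \<le> real (\<Sum>i\<in>I. card (?P i))"
    by (rule of_nat_mono)
  then have "fact (card S) \<le> (\<Sum>i\<in>I. real (card (?P i)))"
    by (simp only: card_permutations[OF refl S] of_nat_fact of_nat_sum)
  also have "\<dots> = (\<Sum>i\<in>I. fact (card S) * (1 / real (card S choose card (A i))))"
  proof (rule sum.cong[OF refl])
    fix i assume i: "i \<in> I"
    have "0 < card S choose card (A i)"
      using sub(1)[OF i] S by (simp add: card_mono)
    moreover have "real (card (?P i)) * real (card S choose card (A i)) = fact (card S)"
      using card_permutes_image_eq[OF S sub(1)[OF i] sub(2)[OF i] card[OF i]]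
      by (metis of_nat_fact of_nat_mult)
    ultimately show "real (card (?P i)) = fact (card S) * (1 / real (card S choose card (A i)))"
      by (simp add: field_simps)
  qed
  also have "\<dots> < fact (card S)"
    unfolding sum_distrib_left[symmetric] using less by simp
  finally show False by simp
qed

section \<open>The expected number of preserved flats\<close>

definition binomial_factor :: "nat \<Rightarrow> nat \<Rightarrow> nat \<Rightarrow> real" where
  "binomial_factor N Q i = (real N - real i) / (real Q - real i)"

lemma prod_binomial_factor:
  assumes "Q \<le> N"
  shows "(\<Prod>i<Q. binomial_factor N Q i) = real (N choose Q)"
  unfolding binomial_altdef_of_nat[OF assms] binomial_factor_def lessThan_atLeast0
  using assms by (intro prod.cong) (auto simp: of_nat_diff)

lemma binomial_factor_mono:
  assumes "i \<le> j" "j < Q" "Q \<le> N"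
  shows "binomial_factor N Q i \<le> binomial_factor N Q j"
proof -
  have "(real N - real j) * (real Q - real i) - (real N - real i) * (real Q - real j)
      = (real N - real Q) * (real j - real i)"
    by (simp add: algebra_simps)
  also have "\<dots> \<ge> 0"
    using assms by simp
  finally show ?thesis
    using assms by (simp add: binomial_factor_def frac_le_eq divide_simps)
qed

lemma twice_binomial_factor_le_last:
  assumes m: "m + 3 \<le> Q" and N: "3 * Q \<le> N + 2 * m"
  shows "2 * binomial_factor N Q m \<le> binomial_factor N Q (Q - 1)"
proof -
  have Q: "3 \<le> real Q - real m" "3 * real Q \<le> real N + 2 * real m" "real Q \<le> real N"
    using assms by linarith+
  have "2 * (real N - real m) \<le> 3 * (real N - real Q + 1)"
    using Q by argo
  also have "\<dots> \<le> (real Q - real m) * (real N - real Q + 1)"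
    using Q by (intro mult_right_mono) auto
  finally have "2 * ((real N - real m) / (real Q - real m)) \<le> real N - real Q + 1"
    using Q by (simp add: pos_divide_le_eq mult.commute)
  also have "\<dots> = binomial_factor N Q (Q - 1)"
    using m by (simp add: binomial_factor_def of_nat_diff)
  finally show ?thesis
    by (simp add: binomial_factor_def)
qed

lemma times_power_le_prod:
  fixes r :: "'i \<Rightarrow> 'a::linordered_semidom"
  assumes "finite R" "R \<noteq> {}" and R: "\<And>i. i \<in> R \<Longrightarrow> b \<le> r i \<and> c \<le> r i" and "0 \<le> b" "0 \<le> c"
  shows "b * c ^ (card R - 1) \<le> prod r R"
proof -
  obtain a where a: "a \<in> R"
    using assms(2) by blast
  have "c ^ (card R - 1) \<le> prod r (R - {a})"
    using a R assms(1,5) prod_mono[of "R - {a}" "\<lambda>_. c" r] by simp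
  then have "b * c ^ (card R - 1) \<le> r a * prod r (R - {a})"
    using a R assms(4,5) by (intro mult_mono) (auto intro: order_trans)
  then show ?thesis
    using a assms(1) by (simp add: prod.remove)
qed

lemma twice_power_le_prod_top:
  fixes r :: "nat \<Rightarrow> real"
  assumes mono: "\<And>i j. i \<le> j \<Longrightarrow> j < Q \<Longrightarrow> r i \<le> r j"
    and k: "1 \<le> k" "m + k < Q" and nonneg: "0 \<le> r m" and last: "2 * r m \<le> r (Q - 1)"
  shows "2 * r m ^ k \<le> prod r {Q - k..<Q}"
proof -
  have "2 * r m ^ k = (2 * r m) * (\<Prod>i\<in>{Q - k..<Q - 1}. r m)"
    using k by (simp add: power_eq_if)
  also have "\<dots> \<le> r (Q - 1) * (\<Prod>i\<in>{Q - k..<Q - 1}. r i)"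
    using k nonneg last by (intro mult_mono prod_mono conjI prod_nonneg mono) auto
  also have "\<dots> = prod r {Q - k..<Q}"
    using k prod.atLeastLessThan_Suc[of "Q - k" "Q - 1" r] by (simp add: mult.commute)
  finally show ?thesis .
qed

lemma prod_lessThan_split:
  fixes r :: "nat \<Rightarrow> 'a::comm_monoid_mult"
  assumes S: "S \<subseteq> {1..m}" and Q: "m + card S < Q"
  defines "T \<equiv> {Q - card S..<Q}"
  defines "R \<equiv> {..<Q} - insert 0 S - T"
  shows "r 0 * prod r S * (prod r T * prod r R) = (\<Prod>i<Q. r i)" "card R = Q - (2 * card S + 1)"
proof -
  have fin: "finite S" and S0: "0 \<notin> S"
    using S by (auto intro: finite_subset)
  have sub: "insert 0 S \<subseteq> {..<Q}" and T: "T \<subseteq> {..<Q} - insert 0 S"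
    using S Q by (fastforce simp: T_def)+
  have "prod r T * prod r R = prod r ({..<Q} - insert 0 S)"
    using prod.subset_diff[OF T, of r] by (simp add: R_def mult.commute)
  moreover have "r 0 * prod r S = prod r (insert 0 S)"
    using fin S0 by simp
  ultimately show "r 0 * prod r S * (prod r T * prod r R) = (\<Prod>i<Q. r i)"
    using prod.subset_diff[OF sub, of r] by (simp add: mult.commute)
  have "card R = card {..<Q} - card (insert 0 S) - card T"
    unfolding R_def using fin T sub by (simp add: card_Diff_subset T_def)
  then show "card R = Q - (2 * card S + 1)"
    using fin S0 Q by (simp add: T_def)
qed

lemma prod_sq_le_prod_lessThan:
  fixes r :: "nat \<Rightarrow> real"
  assumes mono: "\<And>i j. i \<le> j \<Longrightarrow> j < Q \<Longrightarrow> r i \<le> r j" and r0: "2 \<le> r 0"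
    and S: "S \<subseteq> {1..m}" and k: "1 \<le> card S" "2 * card S + 2 \<le> Q" "m + card S < Q"
    and last: "2 * r m \<le> r (Q - 1)"
  shows "(r 0 * prod r S)\<^sup>2 * 2 ^ (Q - (2 * card S + 1)) \<le> (\<Prod>i<Q. r i)"
proof -
  let ?k = "card S" and ?T = "{Q - card S..<Q}"
  let ?R = "{..<Q} - insert 0 S - ?T"
  note split = prod_lessThan_split[OF S k(3)]
  have r2: "2 \<le> r i" if "i < Q" for i
    using mono[of 0 i] r0 that by linarith
  have S_less: "i \<le> m \<and> i < Q" if "i \<in> S" for i
    using that S k by auto
  then have S_bounds: "0 \<le> r i" "r i \<le> r m" if "i \<in> S" for i
    using that r2[of i] mono[of i m] k(3) by fastforce+
  have "?R \<noteq> {}"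
    using split(2) k by (intro notI) (simp del: card_eq_0_iff)
  then have R: "r 0 * 2 ^ (card ?R - 1) \<le> prod r ?R"
    using r0 r2 mono by (intro times_power_le_prod) auto
  have T: "2 * r m ^ ?k \<le> prod r ?T"
    using mono k last r2[of m] by (intro twice_power_le_prod_top) auto
  have "prod r S \<le> (\<Prod>i\<in>S. r m)"
    using S_bounds by (intro prod_mono) auto
  then have "r 0 * prod r S * 2 ^ card ?R \<le> r 0 * r m ^ ?k * 2 ^ card ?R"
    using r0 by (intro mult_right_mono mult_left_mono) auto
  also have "\<dots> = (2 * r m ^ ?k) * (r 0 * 2 ^ (card ?R - 1))"
    using split(2) k by (simp add: power_eq_if)
  also have "\<dots> \<le> prod r ?T * prod r ?R"
    using R r0 r2[of m] k by (intro mult_mono order_trans[OF _ T]) auto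
  finally have "(r 0 * prod r S) * (r 0 * prod r S * 2 ^ card ?R) \<le> (\<Prod>i<Q. r i)"
    unfolding split(1)[symmetric] using r0 S_bounds
    by (intro mult_left_mono mult_nonneg_nonneg prod_nonneg) auto
  then show ?thesis
    by (simp only: split(2) power2_eq_square mult.assoc)
qed

lemma card_flats_eq_prod_binomial_factor:
  fixes q k n :: nat
  defines "q \<equiv> CARD('a::{field,finite})" and "n \<equiv> CARD('n)"
  assumes k: "k \<le> n"
  shows "real (card {Z :: ('a ^ 'n) set. is_flat k Z}) =
    binomial_factor (q ^ n) (q ^ k) 0 * (\<Prod>i<k. binomial_factor (q ^ n) (q ^ k) (q ^ i))"
proof -
  have q: "1 < q"
    using two_le_CARD[where 'a = 'a] by (simp add: q_def)
  have diff: "real (q ^ l - q ^ i) = real (q ^ l) - real (q ^ i)" if "i < k" "k \<le> l" for i l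
    using that q by (intro of_nat_diff power_increasing) auto
  let ?F = "{Z :: ('a ^ 'n) set. is_flat k Z}"
  have count: "real (card ?F) * real (q ^ k * (\<Prod>i<k. q ^ k - q ^ i)) =
      real (q ^ n * (\<Prod>i<k. q ^ n - q ^ i))"
    unfolding q_def n_def by (simp only: card_flats flip: of_nat_mult)
  have nonzero: "real (q ^ k * (\<Prod>i<k. q ^ k - q ^ i)) \<noteq> 0"
    using q by (simp add: power_strict_increasing)
  have "real (card ?F) =
      real (q ^ n * (\<Prod>i<k. q ^ n - q ^ i)) / real (q ^ k * (\<Prod>i<k. q ^ k - q ^ i))"
    by (simp only: nonzero_eq_divide_eq[OF nonzero] count)
  also have "\<dots> = real (q ^ n) / real (q ^ k) *
      ((\<Prod>i<k. real (q ^ n - q ^ i)) / (\<Prod>i<k. real (q ^ k - q ^ i)))"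
    by simp
  also have "real (q ^ n) / real (q ^ k) = binomial_factor (q ^ n) (q ^ k) 0"
    by (simp add: binomial_factor_def)
  also have "(\<Prod>i<k. real (q ^ n - q ^ i)) / (\<Prod>i<k. real (q ^ k - q ^ i)) =
      (\<Prod>i<k. real (q ^ n - q ^ i) / real (q ^ k - q ^ i))"
    by (rule prod_dividef[symmetric])
  also have "\<dots> = (\<Prod>i<k. binomial_factor (q ^ n) (q ^ k) (q ^ i))"
    using k by (intro prod.cong refl) (simp only: binomial_factor_def diff lessThan_iff order_refl)
  finally show ?thesis .
qed

lemma power_diff_pred_bounds:
  fixes q k :: nat
  assumes q: "2 \<le> q" and k: "1 \<le> k" "2 * k + 2 \<le> q ^ k"
  shows "q ^ (k - 1) + k < q ^ k" "q ^ (k - 1) + 3 \<le> q ^ k"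
proof -
  have half: "2 * q ^ (k - 1) \<le> q ^ k"
    using q k(1) by (simp add: power_eq_if)
  with k(2) show "q ^ (k - 1) + k < q ^ k"
    by linarith
  show "q ^ (k - 1) + 3 \<le> q ^ k"
  proof (cases "k = 1")
    case True
    then show ?thesis using k(2) by simp
  next
    case False
    then show ?thesis using half k by linarith
  qed
qed

lemma three_times_power_le:
  fixes q k n :: nat
  assumes q: "2 \<le> q" and k: "1 \<le> k" "k < n"
  shows "3 * q ^ k \<le> q ^ n + 2 * q ^ (k - 1)"
proof -
  obtain d where d: "q = d + 2"
    using q by (metis le_add_diff_inverse2)
  have "3 * q ^ k = 3 * q * q ^ (k - 1)"
    using k(1) by (simp add: power_eq_if)
  also have "\<dots> \<le> (q * q + 2) * q ^ (k - 1)"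
    by (rule mult_le_mono1) (simp add: d algebra_simps)
  also have "\<dots> = q ^ Suc k + 2 * q ^ (k - 1)"
    using k(1) by (simp add: power_eq_if algebra_simps)
  also have "\<dots> \<le> q ^ n + 2 * q ^ (k - 1)"
    using q k(2) by (intro add_right_mono power_increasing) auto
  finally show ?thesis .
qed

lemma prod_binomial_factor_sq_le_binomial:
  fixes q k n :: nat
  defines "r \<equiv> binomial_factor (q ^ n) (q ^ k)"
  assumes q: "2 \<le> q" and k: "1 \<le> k" "k < n" and large: "2 * k + 2 \<le> q ^ k"
  shows "(r 0 * (\<Prod>i<k. r (q ^ i)))\<^sup>2 * 2 ^ (q ^ k - (2 * k + 1)) \<le> real (q ^ n choose q ^ k)"
proof -
  let ?N = "q ^ n" and ?Q = "q ^ k" and ?m = "q ^ (k - 1)" and ?S = "(\<lambda>i. q ^ i) ` {..<k}"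
  note gap = power_diff_pred_bounds[OF q k(1) large]
  have "2 * ?Q \<le> q * ?Q"
    using q by (rule mult_le_mono1)
  also have "\<dots> \<le> ?N"
    using q k(2) power_increasing[of "Suc k" n q] by simp
  finally have QN: "2 * ?Q \<le> ?N" .
  then have "2 * real ?Q \<le> real ?N"
    by (metis of_nat_le_iff of_nat_mult of_nat_numeral)
  then have r0: "2 \<le> r 0"
    using q by (simp add: r_def binomial_factor_def pos_le_divide_eq)
  have last: "2 * r ?m \<le> r (?Q - 1)"
    unfolding r_def using gap(2) three_times_power_le[OF q k] by (rule twice_binomial_factor_le_last)
  have mono: "r i \<le> r j" if "i \<le> j" "j < ?Q" for i j
    unfolding r_def using that QN by (intro binomial_factor_mono) auto
  have inj: "inj_on (\<lambda>i. q ^ i) {..<k}"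
    using q by (intro inj_onI) simp
  then have S: "?S \<subseteq> {1..?m}" "card ?S = k"
    using q by (auto intro: power_increasing simp: card_image)
  have "(r 0 * (\<Prod>i<k. r (q ^ i)))\<^sup>2 * 2 ^ (?Q - (2 * k + 1))
      = (r 0 * prod r ?S)\<^sup>2 * 2 ^ (?Q - (2 * card ?S + 1))"
    by (simp add: S(2) prod.reindex[OF inj])
  also have "\<dots> \<le> (\<Prod>i<?Q. r i)"
    using k(1) large gap(1) S(2)
    by (intro prod_sq_le_prod_lessThan[OF mono r0 S(1) _ _ _ last]) auto
  also have "\<dots> = real (?N choose ?Q)"
    unfolding r_def using QN by (intro prod_binomial_factor) linarith
  finally show ?thesis .
qed

lemma linear_le_power:
  fixes q k :: nat
  assumes "2 \<le> q" "1 \<le> k" "2 * k + 2 \<le> q ^ k" "k \<le> j"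
  shows "3 * j + 2 \<le> q ^ j + k"
  using assms(4)
proof (induction j rule: dec_induct)
  case base
  show ?case using assms(3) by simp
next
  case (step i)
  then have "3 * Suc i + 2 \<le> 2 * q ^ i + k"
    using assms(2) by simp
  also have "2 * q ^ i \<le> q ^ Suc i"
    using assms(1) by simp
  finally show ?case by simp
qed

lemma expected_preserved_flats_le:
  assumes k0: "1 \<le> k0" "2 * k0 + 2 \<le> CARD('a::{field,finite}) ^ k0"
    and k: "k0 \<le> k" "k < CARD('n)"
  shows "(real (card {Z :: ('a ^ 'n) set. is_flat k Z}))\<^sup>2 /
      real (CARD('a ^ 'n) choose CARD('a) ^ k) \<le> (1/2) ^ (k - k0 + 1)"
proof -
  let ?q = "CARD('a)" and ?n = "CARD('n)" and ?c = "real (card {Z :: ('a ^ 'n) set. is_flat k Z})"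
  have growth: "3 * k + 2 \<le> ?q ^ k + k0"
    using linear_le_power[OF two_le_CARD k0 k(1)] .
  have "?c\<^sup>2 * 2 ^ (k - k0 + 1) \<le> ?c\<^sup>2 * 2 ^ (?q ^ k - (2 * k + 1))"
    using growth k by (intro mult_left_mono power_increasing) auto
  also have "\<dots> \<le> real (?q ^ ?n choose ?q ^ k)"
    unfolding card_flats_eq_prod_binomial_factor[where 'a = 'a and 'n = 'n, OF less_imp_le[OF k(2)]]
    using growth k k0 by (intro prod_binomial_factor_sq_le_binomial two_le_CARD) auto
  finally have "?c\<^sup>2 * 2 ^ (k - k0 + 1) \<le> real (?q ^ ?n choose ?q ^ k)" .
  moreover have "0 < ?q ^ ?n choose ?q ^ k"
    using k two_le_CARD[where 'a = 'a] by (simp add: power_increasing)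
  ultimately show ?thesis
    by (simp add: divide_simps mult.commute)
qed

lemma sum_expected_preserved_flats_less_1:
  assumes k0: "1 \<le> k0" "2 * k0 + 2 \<le> CARD('a::{field,finite}) ^ k0"
  shows "(\<Sum>k\<in>{k0..<CARD('n)}. (real (card {Z :: ('a ^ 'n) set. is_flat k Z}))\<^sup>2 /
      real (CARD('a ^ 'n) choose CARD('a) ^ k)) < 1"
    (is "?lhs < 1")
proof -
  have "?lhs \<le> (\<Sum>k\<in>{k0..<CARD('n)}. (1/2) ^ (k - k0 + 1))"
    using expected_preserved_flats_le[where 'n = 'n, OF k0]
    by (intro sum_mono) (simp only: atLeastLessThan_iff)
  also have "\<dots> = (\<Sum>j<CARD('n) - k0. (1/2) ^ (j + 1))"
    by (rule sum.reindex_bij_witness[of _ "\<lambda>j. j + k0" "\<lambda>k. k - k0"]) auto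
  also have "\<dots> < 1"
  proof -
    have "(\<Sum>j<m. (1/2::real) ^ (j + 1)) = 1 - (1/2) ^ m" for m
      by (induction m) auto
    then show ?thesis by simp
  qed
  finally show ?thesis .
qed

lemma exists_bij_affinity_eq_0:
  assumes k0: "1 \<le> k0" "2 * k0 + 2 \<le> CARD('a::{field,finite}) ^ k0"
  shows "\<exists>f :: 'a ^ 'n \<Rightarrow> 'a ^ 'n. bij f \<and> (\<forall>k. k0 \<le> k \<and> k < CARD('n) \<longrightarrow> affinity k f = 0)"
proof -
  let ?F = "\<lambda>k. {Z :: ('a ^ 'n) set. is_flat k Z}"
  let ?I = "SIGMA k:{k0..<CARD('n)}. ?F k \<times> ?F k"
  have "(\<Sum>i\<in>?I. 1 / real (CARD('a ^ 'n) choose card (fst (snd i))))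
      = (\<Sum>(k, _)\<in>?I. 1 / real (CARD('a ^ 'n) choose CARD('a) ^ k))"
    by (intro sum.cong) (auto simp: card_flat)
  also have "\<dots> = (\<Sum>k\<in>{k0..<CARD('n)}. \<Sum>_\<in>?F k \<times> ?F k. 1 / real (CARD('a ^ 'n) choose CARD('a) ^ k))"
    by (rule sum.Sigma[symmetric]) simp_all
  also have "\<dots> < 1"
    using sum_expected_preserved_flats_less_1[OF k0, where 'n = 'n]
    by (simp add: card_cartesian_product power2_eq_square)
  finally have "\<exists>f. f permutes UNIV \<and> (\<forall>i\<in>?I. f ` fst (snd i) \<noteq> snd (snd i))"
    by (intro exists_permutes_image_neq) (auto simp: card_flat)
  then obtain f where "f permutes UNIV" and f: "\<forall>i\<in>?I. f ` fst (snd i) \<noteq> snd (snd i)"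
    by blast
  then have "bij f"
    by (simp add: permutes_imp_bij)
  moreover have "affinity k f = 0" if "k0 \<le> k" "k < CARD('n)" for k
    unfolding affinity_eq_0_iff
  proof (intro allI impI notI)
    fix Z assume "is_flat k Z" "is_flat k (f ` Z)"
    then have "(k, Z, f ` Z) \<in> ?I"
      using that by simp
    from bspec[OF f this] show False by simp
  qed
  ultimately show ?thesis by blast
qed

section \<open>The subfield of order \<open>q ^ n\<close>\<close>

lemma size_proots_alg_closed: "size (proots p) = degree (p :: 'a::alg_closed_field poly)"
proof (cases "p = 0")
  case False
  then obtain A where A: "size A = degree p" "p = smult (lead_coeff p) (\<Prod>x\<in>#A. [:-x, 1:])"
    using alg_closed_imp_factorization by blast
  have "proots p = proots (\<Prod>x\<in>#A. [:-x, 1:])"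
    using A(2) False by (metis leading_coeff_0_iff proots_smult)
  also have "\<dots> = A"
  proof (induction A)
    case (add x A)
    have "(\<Prod>y\<in>#A. [:-y, 1:]) \<noteq> 0"
      by (auto simp: prod_mset_zero_iff)
    then show ?case
      using add by (simp add: proots_mult del: mult_pCons_left)
  qed simp
  finally show ?thesis by (simp add: A(1))
qed simp

lemma order_le_1_if_simple_root:
  fixes p :: "'a::idom poly"
  assumes p: "p \<noteq> 0" and simple: "poly p x = 0 \<Longrightarrow> poly (pderiv p) x \<noteq> 0"
  shows "order x p \<le> 1"
proof (rule ccontr)
  assume "\<not> order x p \<le> 1"
  then have "[:-x, 1:] ^ 2 dvd p"
    by (intro order_divides[THEN iffD2]) auto
  then obtain q where "p = [:-x, 1:] ^ 2 * q"
    by (rule dvdE)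
  then have q: "p = [:-x, 1:] * ([:-x, 1:] * q)"
    by (simp only: power2_eq_square mult.assoc)
  have "poly p x = 0"
    by (simp add: q)
  moreover have "poly (pderiv p) x = 0"
    unfolding q by (simp only: pderiv_mult poly_add poly_mult) simp
  ultimately show False
    using simple by blast
qed

lemma card_roots_eq_degree:
  fixes p :: "'a::alg_closed_field poly"
  assumes p: "p \<noteq> 0" and simple: "\<And>x. poly p x = 0 \<Longrightarrow> poly (pderiv p) x \<noteq> 0"
  shows "card {x. poly p x = 0} = degree p"
proof -
  have "proots p = mset_set {x. poly p x = 0}"
  proof (rule multiset_eqI)
    fix x
    have "order x p = (if poly p x = 0 then 1 else 0)"
      using order_le_1_if_simple_root[OF p simple, of x] order_root[of p x] p by auto
    then show "count (proots p) x = count (mset_set {x. poly p x = 0}) x"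
      using p by (simp add: poly_roots_finite)
  qed
  then show ?thesis
    using size_proots_alg_closed[of p] by simp
qed

definition power_fixed :: "nat \<Rightarrow> 'a::monoid_mult set" where
  "power_fixed m = {x. x ^ m = x}"

lemma power_fixed_1: "1 \<in> power_fixed m"
  by (simp add: power_fixed_def)

lemma power_fixed_0: "0 < m \<Longrightarrow> (0 :: 'a::semiring_1) \<in> power_fixed m"
  by (simp add: power_fixed_def zero_power)

lemma power_fixed_mult:
  fixes x y :: "'a::comm_monoid_mult"
  shows "x \<in> power_fixed m \<Longrightarrow> y \<in> power_fixed m \<Longrightarrow> x * y \<in> power_fixed m"
  by (simp add: power_fixed_def power_mult_distrib)

lemma power_fixed_power:
  fixes x :: "'a::comm_monoid_mult"
  shows "x \<in> power_fixed m \<Longrightarrow> x ^ j \<in> power_fixed m"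
  by (induction j) (simp_all add: power_fixed_1 power_fixed_mult)

lemma power_fixed_inverse:
  fixes x :: "'a::field"
  shows "x \<in> power_fixed m \<Longrightarrow> inverse x \<in> power_fixed m"
  by (simp add: power_fixed_def power_inverse)

lemma power_fixed_uminus:
  fixes x :: "'a::ring_1"
  shows "odd m \<Longrightarrow> x \<in> power_fixed m \<Longrightarrow> - x \<in> power_fixed m"
  by (simp add: power_fixed_def power_minus_odd)

lemma power_fixed_add:
  fixes x y :: "'a::comm_semiring_1"
  assumes "prime CHAR('a)" "x \<in> power_fixed (CHAR('a) ^ n)" "y \<in> power_fixed (CHAR('a) ^ n)"
  shows "x + y \<in> power_fixed (CHAR('a) ^ n)"
  using assms by (simp add: power_fixed_def freshmans_dream')

lemma card_power_fixed:
  assumes m: "2 \<le> m" "CHAR('a::alg_closed_field) dvd m"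
  shows "card (power_fixed m :: 'a set) = m"
proof -
  define P :: "'a poly" where "P = monom 1 m - monom 1 1"
  have deg: "degree P = m"
    unfolding P_def diff_conv_add_uminus using m(1)
    by (subst degree_add_eq_left) (auto simp: degree_monom_eq)
  have "pderiv P = [:-1:]"
    using m(2)
    by (simp add: P_def pderiv_diff pderiv_monom monom_0 flip: of_nat_eq_0_iff_char_dvd)
  then have "card {x. poly P x = 0} = degree P"
    using deg m(1) by (intro card_roots_eq_degree) auto
  moreover have "{x. poly P x = 0} = power_fixed m"
    by (auto simp: P_def poly_monom power_fixed_def)
  ultimately show ?thesis
    using deg by simp
qed

lemma bij_betw_power_power_fixed:
  assumes fin: "finite (power_fixed N :: 'a::field set)" and m: "0 < m" "coprime m (N - 1)"
  shows "bij_betw (\<lambda>x. x ^ m) (power_fixed N) (power_fixed N :: 'a set)"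
proof -
  have "inj_on (\<lambda>x. x ^ m) (power_fixed N :: 'a set)"
  proof (rule inj_onI)
    fix x y :: 'a
    assume xy: "x \<in> power_fixed N" "y \<in> power_fixed N" and eq: "x ^ m = y ^ m"
    show "x = y"
    proof (cases "y = 0")
      case True
      then show ?thesis using eq m(1) by (auto simp: power_0_left)
    next
      case False
      define t where "t = x * inverse y"
      have tm: "t ^ m = 1"
        using False eq by (simp add: t_def power_mult_distrib power_inverse)
      then have "t \<noteq> 0"
        using m(1) by (auto simp: zero_power)
      moreover have "t ^ N = t"
        using power_fixed_mult[OF xy(1) power_fixed_inverse[OF xy(2)]]
        by (simp add: t_def power_fixed_def)
      ultimately have tN: "t ^ (N - 1) = 1"
        by (cases N) auto
      obtain a b where "m * a = (N - 1) * b + 1"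
        using bezout_nat[of m "N - 1"] m by auto
      then have "(t ^ m) ^ a = (t ^ (N - 1)) ^ b * t"
        by (simp flip: power_mult add: power_add)
      then have "t = 1"
        by (simp only: tm tN power_one mult_1_left)
      then show ?thesis
        using False by (simp add: t_def field_simps)
    qed
  qed
  then show ?thesis
    using endo_inj_surj[OF fin, of "\<lambda>x. x ^ m"] power_fixed_power by (auto simp: bij_betw_def)
qed

lemma power_card_eq_same:
  fixes x :: "'a::{field,finite}"
  shows "x ^ CARD('a) = x"
proof (cases "x = 0")
  case False
  have "x ^ card (UNIV - {0 :: 'a}) * (\<Prod>y\<in>UNIV - {0}. y) = (\<Prod>y\<in>UNIV - {0}. x * y)"
    by (simp add: prod.distrib)
  also have "\<dots> = (\<Prod>y\<in>UNIV - {0}. y)"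
    by (rule prod.reindex_bij_witness[of _ "\<lambda>y. y / x" "\<lambda>y. x * y"]) (use False in auto)
  finally have "x ^ card (UNIV - {0 :: 'a}) = 1"
    by simp
  moreover have "Suc (card (UNIV - {0 :: 'a})) = CARD('a)"
    by (rule card_Suc_Diff1) auto
  ultimately show ?thesis
    by (metis mult.right_neutral power_Suc)
qed simp

lemma to_ac_in_power_fixed: "to_ac (c :: 'a::{field,finite}) \<in> power_fixed (CARD('a) ^ n)"
proof -
  have "c ^ CARD('a) ^ n = c"
    by (induction n) (simp_all add: power_card_eq_same power_mult)
  then show ?thesis
    by (simp add: power_fixed_def flip: to_ac_power)
qed

lemma CHAR_eq_CARD:
  assumes "prime CARD('a::{field,finite})"
  shows "CHAR('a) = CARD('a)"
  using assms CHAR_dvd_CARD[where 'a = 'a] by (auto simp: prime_nat_iff)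

lemma card_power_fixed_CARD_power:
  assumes p: "prime CARD('a::{field,finite})" and n: "0 < n"
  shows "card (power_fixed (CARD('a) ^ n) :: 'a alg_closure set) = CARD('a) ^ n"
proof (rule card_power_fixed)
  have "CARD('a) ^ 1 \<le> CARD('a) ^ n"
    using p n by (intro power_increasing) (auto simp: prime_ge_1_nat)
  then show "2 \<le> CARD('a) ^ n"
    using prime_ge_2_nat[OF p] by simp
  show "CHAR('a alg_closure) dvd CARD('a) ^ n"
    using n by (simp add: CHAR_eq_CARD[OF p] dvd_power)
qed

lemma finite_power_fixed_CARD_power:
  assumes "prime CARD('a::{field,finite})" "0 < n"
  shows "finite (power_fixed (CARD('a) ^ n) :: 'a alg_closure set)"
  using card_power_fixed_CARD_power[OF assms] by (intro card_ge_0_finite) simp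

lemma exists_linear_bij_betw_subspace:
  fixes scale :: "'a::{field,finite} \<Rightarrow> 'b \<Rightarrow> 'b::ab_group_add" (infixr "\<star>" 75)
  assumes "vector_space scale"
    and U: "module.subspace scale U" "card U = CARD('a) ^ CARD('n::finite)"
  obtains \<phi> :: "'a ^ 'n \<Rightarrow> 'b" where "Vector_Spaces.linear (*s) scale \<phi>" "bij_betw \<phi> UNIV U"
proof -
  interpret vector_space scale by fact
  have finU: "finite U"
    using U(2) by (intro card_ge_0_finite) simp
  obtain B where B: "B \<subseteq> U" "independent B" "U \<subseteq> span B" "card B = dim U"
    by (rule basis_exists)
  have finB: "finite B"
    using B(1) finU by (rule finite_subset)
  have span: "span B = U"
    using B U(1) by (simp add: span_minimal subset_antisym)
  have "card B = CARD('n)"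
    using card_subspace[OF finU U(1)] U(2) B(4) two_le_CARD[where 'a = 'a] by simp
  then obtain b where b: "bij_betw b (UNIV :: 'n set) B"
    using finB finite_same_card_bij by (metis finite)
  define \<phi> where "\<phi> v = (\<Sum>i\<in>UNIV. v $ i \<star> b i)" for v :: "'a ^ 'n"
  have lin: "Vector_Spaces.linear (*s) scale \<phi>"
    by unfold_locales (simp_all add: \<phi>_def scale_left_distrib sum.distrib scale_sum_right)
  have "range \<phi> = span B"
  proof (intro equalityI subsetI)
    fix y assume "y \<in> range \<phi>"
    moreover have "b i \<in> B" for i
      using b by (auto simp: bij_betw_def)
    ultimately show "y \<in> span B"
      by (auto simp: \<phi>_def intro: span_sum span_scale span_base)
  next
    fix y assume "y \<in> span B"
    then obtain u where "y = (\<Sum>x\<in>B. u x \<star> x)"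
      using span_finite[OF finB] by auto
    also have "\<dots> = \<phi> (\<chi> i. u (b i))"
      unfolding \<phi>_def using sum.reindex_bij_betw[OF b, of "\<lambda>x. u x \<star> x"] by simp
    finally show "y \<in> range \<phi>" by blast
  qed
  moreover have "inj \<phi>"
    using U(2) \<open>range \<phi> = span B\<close> by (intro eq_card_imp_inj_on) (simp_all add: span)
  ultimately have "bij_betw \<phi> UNIV U"
    by (simp add: bij_betw_def span)
  with lin show ?thesis by (rule that)
qed

lemma exists_additive_bij_betw_power_fixed:
  assumes p: "prime CARD('a::{field,finite})"
  obtains \<phi> :: "'a::{field,finite} ^ 'n \<Rightarrow> 'a alg_closure" where
    "additive \<phi>" "bij_betw \<phi> UNIV (power_fixed (CARD('a) ^ CARD('n)))"
proof -
  let ?F = "power_fixed (CARD('a) ^ CARD('n)) :: 'a alg_closure set"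
  let ?scale = "\<lambda>(c::'a) x. to_ac c * x"
  have char: "CHAR('a) = CARD('a)"
    using p by (rule CHAR_eq_CARD)
  interpret V: vector_space ?scale
    by unfold_locales (auto simp: algebra_simps)
  have "x + y \<in> ?F" if "x \<in> ?F" "y \<in> ?F" for x y
    using power_fixed_add[where 'a = "'a alg_closure"] that p by (simp add: char)
  then have "V.subspace ?F"
    unfolding V.subspace_def by (auto intro!: power_fixed_mult power_fixed_0 to_ac_in_power_fixed)
  moreover have "card ?F = CARD('a) ^ CARD('n)"
    using p by (simp add: card_power_fixed_CARD_power)
  ultimately obtain \<phi> :: "'a ^ 'n \<Rightarrow> 'a alg_closure" where
    lin: "Vector_Spaces.linear (*s) ?scale \<phi>" and bij: "bij_betw \<phi> UNIV ?F"
    using exists_linear_bij_betw_subspace[OF V.vector_space_axioms] by blast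
  interpret lin: Vector_Spaces.linear "(*s)" ?scale \<phi>
    by (rule lin)
  have "additive \<phi>"
    by (intro additive.intro lin.add)
  then show ?thesis
    using bij by (rule that)
qed

section \<open>Permutations destroying zero-sum sets\<close>

lemma exists_bij_affinity_eq_0_if_zero_sum_free:
  fixes g :: "'a::{field,finite} alg_closure \<Rightarrow> 'a alg_closure"
  defines "F \<equiv> power_fixed (CARD('a) ^ CARD('n))"
  assumes p: "prime CARD('a)" and k: "2 < CARD('a) ^ k" and g: "bij_betw g F F"
    and no_zero_sum: "\<And>Y. Y \<subseteq> F \<Longrightarrow> card Y = CARD('a) ^ k \<Longrightarrow> \<Sum>Y = 0 \<Longrightarrow> sum g Y \<noteq> 0"
  shows "\<exists>f :: 'a ^ 'n \<Rightarrow> 'a ^ 'n. bij f \<and> affinity k f = 0"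
proof -
  obtain \<phi> :: "'a ^ 'n \<Rightarrow> 'a alg_closure" where "additive \<phi>" and \<phi>: "bij_betw \<phi> UNIV F"
    unfolding F_def using exists_additive_bij_betw_power_fixed[OF p] by blast
  interpret phi: additive \<phi> by fact
  have inj: "inj \<phi>" and ran: "range \<phi> = F"
    using \<phi> by (auto simp: bij_betw_def)
  define f where "f = the_inv_into UNIV \<phi> \<circ> (g \<circ> \<phi>)"
  have f: "bij f"
    unfolding f_def
    by (intro bij_betw_trans[OF bij_betw_trans[OF \<phi> g] bij_betw_the_inv_into[OF \<phi>]])
  have \<phi>f: "\<phi> (f x) = g (\<phi> x)" for x
    unfolding f_def comp_def
    using g inj ran by (intro f_the_inv_into_f) (auto simp: bij_betw_def)
  have "affinity k f = 0"
    unfolding affinity_eq_0_iff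
  proof (intro allI impI notI)
    fix Z assume Z: "is_flat k Z" "is_flat k (f ` Z)"
    have injs: "inj_on f Z" "inj_on \<phi> Z"
      using f inj by (auto dest: bij_is_inj intro: inj_on_subset)
    have "sum g (\<phi> ` Z) = \<phi> (\<Sum>(f ` Z))"
      by (simp add: injs sum.reindex \<phi>f phi.sum)
    also have "\<dots> = 0"
      using sum_flat_eq_0[OF Z(2) k] by (simp add: phi.zero)
    finally have "sum g (\<phi> ` Z) = 0" .
    moreover have "\<Sum>(\<phi> ` Z) = \<phi> (\<Sum>Z)"
      by (simp add: injs sum.reindex phi.sum)
    then have "\<Sum>(\<phi> ` Z) = 0"
      using sum_flat_eq_0[OF Z(1) k] by (simp add: phi.zero)
    moreover have "card (\<phi> ` Z) = CARD('a) ^ k"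
      using card_flat[OF Z(1)] injs by (simp add: card_image)
    ultimately show False
      using no_zero_sum[of "\<phi> ` Z"] ran by blast
  qed
  with f show ?thesis by blast
qed

lemma sum_cubes_neq_0:
  fixes Y :: "'a::idom set"
  assumes char: "CHAR('a) = 2" and Y: "card Y = 4" "\<Sum>Y = 0"
  shows "(\<Sum>y\<in>Y. y ^ 3) \<noteq> 0"
proof -
  have neg: "- x = x" for x :: 'a
    using char by (rule uminus_CHAR_2)
  have two: "2 = (0 :: 'a)"
    using of_nat_CHAR[where 'a = 'a] char by simp
  obtain a b c d where abcd: "Y = {a, b, c, d}" "a \<notin> {b, c, d}" "b \<notin> {c, d}" "c \<noteq> d"
    using Y(1) by (auto simp: numeral_eq_Suc card_Suc_eq)
  have "a + b + c + d = 0"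
    using Y(2) abcd by (simp add: add.assoc)
  then have d: "d = a + b + c"
    using neg by (metis add_eq_0_iff)
  have "(\<Sum>y\<in>Y. y ^ 3) = a ^ 3 + b ^ 3 + c ^ 3 + (a + b + c) ^ 3"
    using abcd d by (simp add: add_ac)
  also have "\<dots> = (a + b) * (b + c) * (c + a)
      + 2 * (a ^ 3 + b ^ 3 + c ^ 3 + (a + b) * (b + c) * (c + a))"
    by (simp add: algebra_simps power3_eq_cube)
  also have "\<dots> = (a + b) * (b + c) * (c + a)"
    by (simp add: two)
  also have "\<dots> \<noteq> 0"
    using abcd neg by (auto simp: add_eq_0_iff)
  finally show ?thesis .
qed

lemma coprime_3_power_2_minus_1:
  assumes "odd n"
  shows "coprime 3 (2 ^ n - 1 :: nat)"
proof -
  obtain m where n: "n = 2 * m + 1"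
    using assms by (rule oddE)
  have "(4::nat) ^ m mod 3 = 1"
    using power_mod[of "4::nat" 3 m] by simp
  then have "(2::nat) ^ n mod 3 = 2"
    by (simp add: n power_mult mod_mult_right_eq[of 2 "4 ^ m" 3, symmetric])
  then have "\<not> 3 dvd (2 ^ n - 1 :: nat)"
    by presburger
  then show ?thesis
    by (intro prime_imp_coprime) auto
qed

lemma exists_bij_2_affinity_eq_0:
  assumes q: "CARD('a::{field,finite}) = 2" and n: "odd CARD('n)"
  shows "\<exists>f :: 'a ^ 'n \<Rightarrow> 'a ^ 'n. bij f \<and> affinity 2 f = 0"
proof (rule exists_bij_affinity_eq_0_if_zero_sum_free)
  let ?F = "power_fixed (CARD('a) ^ CARD('n)) :: 'a alg_closure set"
  have p: "prime CARD('a)"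
    using q by simp
  then have char: "CHAR('a alg_closure) = 2"
    using q by (simp add: CHAR_eq_CARD)
  show "bij_betw (\<lambda>x. x ^ 3) ?F ?F"
    using coprime_3_power_2_minus_1[OF n] q finite_power_fixed_CARD_power[OF p]
    by (intro bij_betw_power_power_fixed) auto
  show "(\<Sum>y\<in>Y. y ^ 3) \<noteq> 0" if "card Y = CARD('a) ^ 2" "\<Sum>Y = 0" for Y :: "'a alg_closure set"
    using that q by (intro sum_cubes_neq_0 char) auto
qed (use q in auto)

lemma exists_nonsquare_neq:
  fixes F :: "'a::idom set"
  assumes F: "finite F" "4 \<le> card F" and neg: "\<And>x. x \<in> F \<Longrightarrow> - x \<in> F" and two: "(2 :: 'a) \<noteq> 0"
  shows "\<exists>s\<in>F. s \<noteq> c \<and> (\<forall>d\<in>F. d\<^sup>2 \<noteq> s)"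
proof (rule ccontr)
  assume "\<not> ?thesis"
  then have sub: "F \<subseteq> insert c (power2 ` F)" by auto
  have neq_uminus: "x \<noteq> - x" if "x \<noteq> 0" for x :: 'a
    using that two by (metis add.right_inverse mult_2 mult_eq_0_iff)
  have "\<not> F \<subseteq> {0}"
    using F card_mono[of "{0}" F] by auto
  then obtain t where t: "t \<in> F" "t \<noteq> 0" by blast
  have "card {0, t, - t} \<le> 3"
    by (simp add: card_insert_if)
  then have "\<not> F \<subseteq> {0, t, - t}"
    using F card_mono[of "{0, t, - t}" F] by auto
  then obtain u where u: "u \<in> F" "u \<noteq> 0" "u \<noteq> t" "u \<noteq> - t" by blast
  let ?G = "F - {- t, - u}"
  have "d\<^sup>2 \<in> power2 ` ?G" if d: "d \<in> F" for d
  proof -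
    have "t \<noteq> - u"
      using u(4) by (metis minus_minus)
    then have "t \<in> ?G" "u \<in> ?G"
      using t u neq_uminus[OF t(2)] neq_uminus[OF u(2)] by simp_all
    moreover consider "d \<in> ?G" | "d = - t" | "d = - u"
      using d by blast
    ultimately show ?thesis
      by cases (metis imageI power2_minus)+
  qed
  then have "card (power2 ` F) \<le> card ?G"
    using F(1) by (intro surj_card_le[of _ _ power2]) auto
  also have "\<dots> = card F - 2"
    using F(1) t u neg by (subst card_Diff_subset) auto
  finally have "card (power2 ` F) \<le> card F - 2" .
  moreover have "card (insert c (power2 ` F)) \<le> Suc (card (power2 ` F))"
    using F(1) by (simp add: card_insert_if)
  moreover have "card F \<le> card (insert c (power2 ` F))"
    using sub F(1) by (intro card_mono) auto
  ultimately show False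
    using F(2) by linarith
qed

lemma zero_sum_triple_eq:
  fixes x y :: "'a::ab_group_add"
  assumes Y: "card Y = 3" "\<Sum>Y = 0" and xy: "x \<in> Y" "y \<in> Y" "x \<noteq> y"
  shows "Y = {x, y, - x - y}" "- x - y \<notin> {x, y}"
proof -
  have "card (Y - {x, y}) = 1"
    using Y(1) xy by (subst card_Diff_subset) auto
  then obtain z where "Y - {x, y} = {z}"
    by (rule card_1_singletonE)
  then have z: "Y = {x, y, z}" "z \<notin> {x, y}"
    using xy by blast+
  then have "x + (y + z) = 0"
    using Y(2) xy(3) by auto
  then have "z = - x - y"
    by (metis add.assoc add_eq_0_iff minus_add_distrib uminus_add_conv_diff add_uminus_conv_diff)
  with z show "Y = {x, y, - x - y}" "- x - y \<notin> {x, y}" by simp_all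
qed

lemma zero_sum_tripleE:
  fixes x :: "'a::ab_group_add"
  assumes Y: "card Y = 3" "\<Sum>Y = 0" "x \<in> Y"
  obtains y z where "Y = {x, y, z}" "z = - x - y" "x \<noteq> y" "z \<noteq> x" "z \<noteq> y"
proof -
  have "card (Y - {x}) = 2"
    using Y by simp
  then obtain y where y: "y \<in> Y" "x \<noteq> y"
    by (auto simp: card_2_iff)
  then show ?thesis
    using zero_sum_triple_eq[OF Y y] by (intro that[of y "- x - y"]) auto
qed

lemma sum_inverse_neq_0:
  fixes Y :: "'a::field set"
  assumes three: "3 = (0 :: 'a)" and Y: "card Y = 3" "\<Sum>Y = 0" "0 \<notin> Y"
  shows "sum inverse Y \<noteq> 0"
proof
  assume inv: "sum inverse Y = 0"
  obtain x where "x \<in> Y"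
    using Y(1) by fastforce
  then obtain y z where xyz: "Y = {x, y, z}" "z = - x - y" "x \<noteq> y" "z \<noteq> x" "z \<noteq> y"
    by (rule zero_sum_tripleE[OF Y(1,2)])
  have nz: "x \<noteq> 0" "y \<noteq> 0" "z \<noteq> 0"
    using Y(3) xyz(1) by auto
  have "- (x - y)\<^sup>2 = y * z + x * z + x * y + 3 * (x * y)"
    unfolding xyz(2) by (simp add: algebra_simps power2_eq_square)
  also have "\<dots> = (inverse x + inverse y + inverse z) * (x * y * z)"
    using nz three by (simp add: field_simps)
  also have "inverse x + inverse y + inverse z = 0"
    using inv xyz(1,3-5) by (auto simp: add.assoc)
  finally show False
    using xyz(3) by simp
qed

definition cycled_inverse :: "'a \<Rightarrow> 'a \<Rightarrow> 'a::field" where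
  "cycled_inverse b x = inverse (if x = 0 then 1 else if x = 1 then b else if x = b then 0 else x)"

lemma sum_cycled_inverse_neq_0_if_0:
  assumes b: "b \<notin> {0, 1, - 1 :: 'a::field}" and Y: "card Y = 3" "\<Sum>Y = 0" "0 \<in> Y"
  shows "sum (cycled_inverse b) Y \<noteq> 0"
proof -
  have b_neq: "b \<noteq> 0" "b \<noteq> 1" "b \<noteq> - 1" "- 1 \<noteq> b" "- b \<noteq> 1"
    using b by (auto dest: minus_equation_iff[THEN iffD1])
  consider "1 \<in> Y" | "b \<in> Y" "1 \<notin> Y" | "1 \<notin> Y" "b \<notin> Y" by blast
  then show ?thesis
  proof cases
    case 1
    have "Y = {0, 1, - 1}" "- 1 \<noteq> (1 :: 'a)"
      using zero_sum_triple_eq[OF Y 1] by simp_all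
    then show ?thesis
      using b_neq by (simp add: cycled_inverse_def)
  next
    case 2
    have "Y = {0, b, - b}" "- b \<noteq> b"
      using zero_sum_triple_eq[OF Y 2(1)] b_neq by simp_all
    then show ?thesis
      using b_neq by (simp add: cycled_inverse_def)
  next
    case 3
    obtain y z where yz: "Y = {0, y, z}" "z = - 0 - y" "0 \<noteq> y" "z \<noteq> 0" "z \<noteq> y"
      using Y by (rule zero_sum_tripleE)
    then have "sum (cycled_inverse b) Y = 1 + inverse y + inverse z"
      using 3 by (auto simp: cycled_inverse_def add.assoc)
    then show ?thesis
      by (simp add: yz(2))
  qed
qed

lemma sum_cycled_inverse_neq_0_if_1_b:
  assumes b: "b \<notin> {0, 1 :: 'a::field}"
    and Y: "card Y = 3" "\<Sum>Y = 0" "1 \<in> Y" "b \<in> Y" "0 \<notin> Y"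
  shows "sum (cycled_inverse b) Y \<noteq> 0"
proof
  assume eq0: "sum (cycled_inverse b) Y = 0"
  have "1 \<noteq> b"
    using b by auto
  define z where "z = - 1 - b"
  have Y_eq: "Y = {1, b, z}" "z \<noteq> 1" "z \<noteq> b"
    using zero_sum_triple_eq[OF Y(1-4) \<open>1 \<noteq> b\<close>] by (simp_all add: z_def)
  then have "inverse b + inverse z = 0"
    using eq0 b Y(5) by (auto simp: cycled_inverse_def)
  then have "b = - z"
    by (metis add_eq_0_iff2 inverse_inverse_eq inverse_minus_eq)
  then show False
    by (simp add: z_def)
qed

lemma sum_cycled_inverse_neq_0_if_1:
  assumes three: "3 = (0 :: 'a::field)" and b: "b \<noteq> (0 :: 'a)"
    and Y: "card Y = 3" "\<Sum>Y = 0" "1 \<in> Y" "0 \<notin> Y" "b \<notin> Y"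
    and nonsquare: "\<And>y. y \<in> Y \<Longrightarrow> (y - 1)\<^sup>2 \<noteq> 1 - b"
  shows "sum (cycled_inverse b) Y \<noteq> 0"
proof
  assume eq0: "sum (cycled_inverse b) Y = 0"
  obtain y z where yz: "Y = {1, y, z}" "z = - 1 - y" "1 \<noteq> y" "z \<noteq> 1" "z \<noteq> y"
    using Y(1-3) by (rule zero_sum_tripleE)
  then have nz: "y \<notin> {0, 1, b}" "z \<notin> {0, 1, b}"
    using Y(4,5) by auto
  have "0 = (inverse b + inverse y + inverse z) * (b * y * z)"
    using eq0 yz nz Y(5) by (auto simp: cycled_inverse_def add.assoc)
  also have "\<dots> = y * z + b * (y + z)"
    using nz b by (simp add: field_simps)
  also have "\<dots> = 1 - b - (y - 1)\<^sup>2 - 3 * y"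
    unfolding yz(2) by (simp add: algebra_simps power2_eq_square)
  finally have "(y - 1)\<^sup>2 = 1 - b"
    using three by simp
  then show False
    using nonsquare yz(1) by blast
qed

lemma sum_cycled_inverse_neq_0_if_b:
  assumes b: "b \<noteq> (0 :: 'a::field)" and Y: "card Y = 3" "\<Sum>Y = 0" "b \<in> Y" "0 \<notin> Y" "1 \<notin> Y"
  shows "sum (cycled_inverse b) Y \<noteq> 0"
proof
  assume eq0: "sum (cycled_inverse b) Y = 0"
  obtain y z where yz: "Y = {b, y, z}" "z = - b - y" "b \<noteq> y" "z \<noteq> b" "z \<noteq> y"
    using Y(1-3) by (rule zero_sum_tripleE)
  then have "inverse y + inverse z = 0"
    using eq0 Y(4,5) by (auto simp: cycled_inverse_def)
  then have "y = - z"
    by (metis add_eq_0_iff2 inverse_inverse_eq inverse_minus_eq)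
  then show False
    using b yz(2) by simp
qed

lemma sum_cycled_inverse_neq_0:
  assumes three: "3 = (0 :: 'a::field)" and b: "b \<notin> {0, 1, - 1 :: 'a}"
    and Y: "card Y = 3" "\<Sum>Y = 0" and nonsquare: "\<And>y. y \<in> Y \<Longrightarrow> (y - 1)\<^sup>2 \<noteq> 1 - b"
  shows "sum (cycled_inverse b) Y \<noteq> 0"
proof -
  consider "0 \<in> Y" | "1 \<in> Y" "b \<in> Y" "0 \<notin> Y" | "1 \<in> Y" "0 \<notin> Y" "b \<notin> Y"
    | "b \<in> Y" "0 \<notin> Y" "1 \<notin> Y" | "0 \<notin> Y" "1 \<notin> Y" "b \<notin> Y"
    by blast
  then show ?thesis
  proof cases
    case 5
    then have "sum (cycled_inverse b) Y = sum inverse Y"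
      using b by (intro sum.cong) (auto simp: cycled_inverse_def)
    then show ?thesis
      using sum_inverse_neq_0[OF three Y] 5 by simp
  qed (use b Y three nonsquare in \<open>simp_all add: sum_cycled_inverse_neq_0_if_0
      sum_cycled_inverse_neq_0_if_1_b sum_cycled_inverse_neq_0_if_1 sum_cycled_inverse_neq_0_if_b\<close>)
qed

lemma bij_betw_cycled_inverse:
  assumes b: "b \<notin> {0, 1}" and F: "finite F" "0 \<in> F" "1 \<in> F" "b \<in> F" "inverse ` F \<subseteq> F"
  shows "bij_betw (cycled_inverse b) F F"
proof -
  have "inj_on (cycled_inverse b) F"
    using b by (auto simp: inj_on_def cycled_inverse_def split: if_splits)
  moreover have "cycled_inverse b ` F \<subseteq> F"
    using b F by (auto simp: cycled_inverse_def)
  ultimately show ?thesis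
    using F(1) by (simp add: bij_betw_def endo_inj_surj)
qed

lemma exists_one_minus_nonsquare:
  fixes F :: "'a::field set"
  assumes three: "3 = (0 :: 'a)" and F: "finite F" "4 \<le> card F" "0 \<in> F" "1 \<in> F"
    and diff: "\<And>x y. x \<in> F \<Longrightarrow> y \<in> F \<Longrightarrow> x - y \<in> F"
  obtains b where "b \<in> F" "b \<notin> {0, 1, - 1}" "\<And>d. d \<in> F \<Longrightarrow> d\<^sup>2 \<noteq> 1 - b"
proof -
  have "2 + 1 = (0 :: 'a)"
    using three by simp
  then have two: "2 = (- 1 :: 'a)"
    by (simp only: eq_neg_iff_add_eq_0)
  have "- x \<in> F" if "x \<in> F" for x
    using diff[OF F(3) that] by simp
  then obtain s where s: "s \<in> F" "s \<noteq> - 1" "\<forall>d\<in>F. d\<^sup>2 \<noteq> s"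
    using exists_nonsquare_neq[OF F(1,2), of "- 1"] two by auto
  define b where "b = 1 - s"
  have s_eq: "s = 1 - b"
    by (simp add: b_def)
  have "s \<noteq> 0\<^sup>2" "s \<noteq> 1\<^sup>2"
    using s(3) F(3,4) by blast+
  then have "b \<notin> {0, 1, - 1}"
    using s(2) two s_eq by auto
  moreover have "b \<in> F"
    unfolding b_def using F(4) s(1) by (rule diff)
  ultimately show ?thesis
    using that s(3) s_eq by blast
qed

lemma exists_bij_1_affinity_eq_0:
  assumes q: "CARD('a::{field,finite}) = 3" and n: "2 \<le> CARD('n)"
  shows "\<exists>f :: 'a ^ 'n \<Rightarrow> 'a ^ 'n. bij f \<and> affinity 1 f = 0"
proof -
  let ?F = "power_fixed (CARD('a) ^ CARD('n)) :: 'a alg_closure set"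
  have p: "prime CARD('a)"
    using q by simp
  then have char: "CHAR('a alg_closure) = 3"
    using q by (simp add: CHAR_eq_CARD)
  then have three: "3 = (0 :: 'a alg_closure)"
    using of_nat_CHAR[where 'a = "'a alg_closure"] by simp
  have F: "finite ?F" "0 \<in> ?F" "1 \<in> ?F" "inverse ` ?F \<subseteq> ?F"
    using finite_power_fixed_CARD_power[OF p] q
    by (auto intro: power_fixed_0 power_fixed_1 power_fixed_inverse)
  have diff: "x - y \<in> ?F" if "x \<in> ?F" "y \<in> ?F" for x y
    using power_fixed_add[of x "CARD('n)" "- y"] power_fixed_uminus[of _ y] that
    unfolding char q by simp
  have "(3::nat) ^ 2 \<le> 3 ^ CARD('n)"
    using n by (intro power_increasing) auto
  then have "4 \<le> card ?F"
    using card_power_fixed_CARD_power[OF p] q by simp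
  with F diff obtain b where b: "b \<in> ?F" "b \<notin> {0, 1, - 1}" "\<And>d. d \<in> ?F \<Longrightarrow> d\<^sup>2 \<noteq> 1 - b"
    using exists_one_minus_nonsquare[OF three, of ?F] by metis
  show ?thesis
  proof (rule exists_bij_affinity_eq_0_if_zero_sum_free[OF p])
    show "bij_betw (cycled_inverse b) ?F ?F"
      using b F by (intro bij_betw_cycled_inverse) auto
    show "sum (cycled_inverse b) Y \<noteq> 0" if "Y \<subseteq> ?F" "card Y = CARD('a) ^ 1" "\<Sum>Y = 0" for Y
      using that q b(3) diff[OF _ F(3)] by (intro sum_cycled_inverse_neq_0[OF three b(2)]) auto
  qed (use q in auto)
qed

theorem theorem2p1:
  shows
    "(CARD('a::{field,finite}) = 2 \<and> CARD('n::finite) \<ge> 3 \<and> odd CARD('n) \<longrightarrow>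
        (\<exists>f :: 'a ^ 'n \<Rightarrow> 'a ^ 'n. bij f \<and> affinity 2 f = 0)) \<and>
     (CARD('a) = 2 \<and> CARD('n) \<ge> 4 \<longrightarrow>
        (\<exists>f :: 'a ^ 'n \<Rightarrow> 'a ^ 'n. bij f \<and>
           (\<forall>k. 3 \<le> k \<and> k \<le> CARD('n) - 1 \<longrightarrow> affinity k f = 0))) \<and>
     (CARD('a) \<ge> 4 \<and> CARD('n) \<ge> 2 \<longrightarrow>
        (\<exists>f :: 'a ^ 'n \<Rightarrow> 'a ^ 'n. bij f \<and>
           (\<forall>k. 1 \<le> k \<and> k \<le> CARD('n) - 1 \<longrightarrow> affinity k f = 0))) \<and>
     (CARD('a) = 3 \<and> CARD('n) \<ge> 3 \<longrightarrow>
        (\<exists>f :: 'a ^ 'n \<Rightarrow> 'a ^ 'n. bij f \<and>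
           (\<forall>k. 2 \<le> k \<and> k \<le> CARD('n) - 1 \<longrightarrow> affinity k f = 0))) \<and>
     (CARD('a) = 3 \<and> CARD('n) \<ge> 2 \<longrightarrow>
        (\<exists>f :: 'a ^ 'n \<Rightarrow> 'a ^ 'n. bij f \<and> affinity 1 f = 0))"
proof -
  have le_iff: "k \<le> CARD('n) - 1 \<longleftrightarrow> k < CARD('n)" for k
    using zero_less_card_finite[where 'a = 'n] by linarith
  show ?thesis
    unfolding le_iff
    by (intro conjI impI exists_bij_2_affinity_eq_0 exists_bij_affinity_eq_0
        exists_bij_1_affinity_eq_0) auto
qed

end
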